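(* For each $\alpha > 1$, there exists a constant $C_\alpha$, depending only on $\alpha$, such that $$\operatorname{cap}^*_{h^2_d}\big(\{\zeta \in \partial\mathbb{B}_d : (M_\alpha f)(\zeta) > t\}\big) \le C_\alpha^2 \frac{\|f\|^2_{h^2_d}}{t^2} \quad \text{for all } f \in h^2_d,\ t > 0.$$
   Context: $\mathbb{B}_d$ is the open Euclidean unit ball of $\mathbb{C}^d$ ($d \ge 1$), with boundary sphere $\partial\mathbb{B}_d$. The pluriharmonic Drury--Arveson space $h^2_d$ is the reproducing kernel Hilbert space on $\mathbb{B}_d$ with kernel $$k(z,w) = 2\operatorname{Re}\frac{1}{1 - \langle z,w\rangle} - 1 = \frac{1 - |\langle z,w\rangle|^2}{|1 - \langle z,w\rangle|^2}.$$ For $\alpha > 1$ and $\zeta \in \partial\mathbb{B}_d$ let $D_\alpha(\zeta) = \{z \in \mathbb{B}_d : |1 - \langle z,\zeta\rangle| < \frac{\alpha}{2}(1 - \|z\|^2)\}$. For $f \in C(\mathbb{B}_d)$, the Korányi maximal function is $(M_\alpha f)(\zeta) = \sup_{z \in D_\alpha(\zeta)} |f(z)|$, $\zeta \in \partial\mathbb{B}_d$. The $h^2_d$-energy of a Borel probability measure $\mu$ on $\partial\mathbb{B}_d$ is $\mathcal{E}(\mu) = \sup_{0 \le r < 1} \int\int k(rz,rw)\, d\mu(w)\, d\mu(z) \in [0,\infty]$. For compact $F \subset \partial\mathbb{B}_d$, $\operatorname{cap}_{h^2_d}(F) = \sup\{1/\mathcal{E}(\mu) : \mu$ a Borel probability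 measure supported on $F\}$ (with $1/\infty = 0$ and $\operatorname{cap}(\emptyset) = 0$). For arbitrary $E \subset \partial\mathbb{B}_d$, the inner capacity is $\operatorname{cap}_{h^2_d}(E) = \sup\{\operatorname{cap}_{h^2_d}(F) : F \subset E \text{ compact}\}$ and the outer capacity is $\operatorname{cap}^*_{h^2_d}(E) = \inf\{\operatorname{cap}_{h^2_d}(G) : G \supset E,\ G \text{ open in } \partial\mathbb{B}_d\}$. *)

theory Defs
  imports "HOL-Analysis.Analysis" "HOL-Probability.Probability"
begin

text \<open>
  The dimension \<open>d\<close> is a term rather than a type index, so that constants can be required to be
  independent of it: \<open>\<complex>\<^sup>d\<close> is the set of sequences that vanish from index \<open>d\<close> on. On this set the
  product topology of the type \<open>nat \<Rightarrow> complex\<close> (hence also its Borel sets and its compact sets)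
  restricts to the Euclidean one.
\<close>

definition cvec :: "nat \<Rightarrow> (nat \<Rightarrow> complex) set" where
  "cvec d = {z. \<forall>i\<ge>d. z i = 0}"

definition hprod :: "nat \<Rightarrow> (nat \<Rightarrow> complex) \<Rightarrow> (nat \<Rightarrow> complex) \<Rightarrow> complex" where
  "hprod d z w = (\<Sum>i<d. z i * cnj (w i))"

definition hnorm :: "nat \<Rightarrow> (nat \<Rightarrow> complex) \<Rightarrow> real" where
  "hnorm d z = L2_set (\<lambda>i. cmod (z i)) {..<d}"

definition cx_ball :: "nat \<Rightarrow> (nat \<Rightarrow> complex) set" where
  "cx_ball d = {z \<in> cvec d. hnorm d z < 1}"

definition cx_sphere :: "nat \<Rightarrow> (nat \<Rightarrow> complex) set" where
  "cx_sphere d = {z \<in> cvec d. hnorm d z = 1}"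

text \<open>
  Reproducing kernel Hilbert spaces of complex functions on a set \<open>X\<close>. A function on \<open>X\<close> is
  represented by its extension by zero to the whole type. By Moore--Aronszajn, a positive
  semidefinite kernel \<open>K\<close> determines \<open>H\<close> and the values of \<open>ip\<close> on \<open>H\<close> uniquely.
\<close>

locale rkhs =
  fixes X :: "'a set"
    and K :: "'a \<Rightarrow> 'a \<Rightarrow> complex"
    and H :: "('a \<Rightarrow> complex) set"
    and ip :: "('a \<Rightarrow> complex) \<Rightarrow> ('a \<Rightarrow> complex) \<Rightarrow> complex"
  assumes zero_outside: "\<lbrakk>f \<in> H; x \<notin> X\<rbrakk> \<Longrightarrow> f x = 0"
    and zero_mem: "(\<lambda>x. 0) \<in> H"
    and add_mem: "\<lbrakk>f \<in> H; g \<in> H\<rbrakk> \<Longrightarrow> (\<lambda>x. f x + g x) \<in> H"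
    and scale_mem: "f \<in> H \<Longrightarrow> (\<lambda>x. c * f x) \<in> H"
    and ip_add_left: "\<lbrakk>f \<in> H; g \<in> H; h \<in> H\<rbrakk> \<Longrightarrow> ip (\<lambda>x. f x + g x) h = ip f h + ip g h"
    and ip_scale_left: "\<lbrakk>f \<in> H; g \<in> H\<rbrakk> \<Longrightarrow> ip (\<lambda>x. c * f x) g = c * ip f g"
    and ip_commute: "\<lbrakk>f \<in> H; g \<in> H\<rbrakk> \<Longrightarrow> ip g f = cnj (ip f g)"
    and ip_nonneg: "f \<in> H \<Longrightarrow> 0 \<le> Re (ip f f)"
    and ip_definite: "\<lbrakk>f \<in> H; ip f f = 0\<rbrakk> \<Longrightarrow> f = (\<lambda>x. 0)"
    and complete:
      "\<lbrakk>\<And>n::nat. F n \<in> H;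
        \<And>e. e > 0 \<Longrightarrow> \<exists>N. \<forall>m\<ge>N. \<forall>n\<ge>N.
          sqrt (Re (ip (\<lambda>x. F m x - F n x) (\<lambda>x. F m x - F n x))) < e\<rbrakk>
       \<Longrightarrow> \<exists>f\<in>H. (\<lambda>n. sqrt (Re (ip (\<lambda>x. F n x - f x) (\<lambda>x. F n x - f x)))) \<longlonglongrightarrow> 0"
    and kernel_mem: "y \<in> X \<Longrightarrow> (\<lambda>x. if x \<in> X then K x y else 0) \<in> H"
    and reproducing: "\<lbrakk>f \<in> H; y \<in> X\<rbrakk> \<Longrightarrow> f y = ip f (\<lambda>x. if x \<in> X then K x y else 0)"

definition ip_norm :: "(('a \<Rightarrow> complex) \<Rightarrow> ('a \<Rightarrow> complex) \<Rightarrow> complex) \<Rightarrow> ('a \<Rightarrow> complex) \<Rightarrow> real" where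
  "ip_norm ip f = sqrt (Re (ip f f))"

definition h2_kernel :: "nat \<Rightarrow> (nat \<Rightarrow> complex) \<Rightarrow> (nat \<Rightarrow> complex) \<Rightarrow> real" where
  "h2_kernel d z w = 2 * Re (1 / (1 - hprod d z w)) - 1"

text \<open>\<open>is_h2 d H ip\<close>: the space \<open>H\<close> with inner product \<open>ip\<close> is the pluriharmonic
  Drury--Arveson space on the unit ball of \<open>\<complex>\<^sup>d\<close>.\<close>

definition is_h2 :: "nat \<Rightarrow> ((nat \<Rightarrow> complex) \<Rightarrow> complex) set
    \<Rightarrow> (((nat \<Rightarrow> complex) \<Rightarrow> complex) \<Rightarrow> ((nat \<Rightarrow> complex) \<Rightarrow> complex) \<Rightarrow> complex) \<Rightarrow> bool" where
  "is_h2 d H ip \<longleftrightarrow> rkhs (cx_ball d) (\<lambda>z w. complex_of_real (h2_kernel d z w)) H ip"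

definition koranyi_region :: "nat \<Rightarrow> real \<Rightarrow> (nat \<Rightarrow> complex) \<Rightarrow> (nat \<Rightarrow> complex) set" where
  "koranyi_region d \<alpha> \<zeta> =
     {z \<in> cx_ball d. cmod (1 - hprod d z \<zeta>) < \<alpha> / 2 * (1 - (hnorm d z)\<^sup>2)}"

definition koranyi_max ::
    "nat \<Rightarrow> real \<Rightarrow> ((nat \<Rightarrow> complex) \<Rightarrow> complex) \<Rightarrow> (nat \<Rightarrow> complex) \<Rightarrow> ennreal" where
  "koranyi_max d \<alpha> f \<zeta> = (SUP z\<in>koranyi_region d \<alpha> \<zeta>. ennreal (cmod (f z)))"

definition sphere_prob :: "nat \<Rightarrow> (nat \<Rightarrow> complex) measure set" where
  "sphere_prob d = {\<mu>. sets \<mu> = sets (restrict_space borel (cx_sphere d)) \<and> prob_space \<mu>}"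

text \<open>The kernel is positive on the open ball, so nothing is truncated by \<open>ennreal\<close> below.\<close>

definition h2_energy :: "nat \<Rightarrow> (nat \<Rightarrow> complex) measure \<Rightarrow> ennreal" where
  "h2_energy d \<mu> = (SUP r\<in>{0..<1}.
     \<integral>\<^sup>+z. \<integral>\<^sup>+w. ennreal (h2_kernel d (\<lambda>i. complex_of_real r * z i) (\<lambda>i. complex_of_real r * w i)) \<partial>\<mu> \<partial>\<mu>)"

text \<open>In \<open>ennreal\<close>, \<open>1 / \<infinity> = 0\<close> and the supremum of the empty set is \<open>0\<close>.\<close>

definition h2_cap_compact :: "nat \<Rightarrow> (nat \<Rightarrow> complex) set \<Rightarrow> ennreal" where
  "h2_cap_compact d F =
     (SUP \<mu>\<in>{\<mu> \<in> sphere_prob d. emeasure \<mu> (cx_sphere d - F) = 0}. 1 / h2_energy d \<mu>)"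

definition h2_inner_cap :: "nat \<Rightarrow> (nat \<Rightarrow> complex) set \<Rightarrow> ennreal" where
  "h2_inner_cap d E = (SUP F\<in>{F. compact F \<and> F \<subseteq> E}. h2_cap_compact d F)"

definition h2_outer_cap :: "nat \<Rightarrow> (nat \<Rightarrow> complex) set \<Rightarrow> ennreal" where
  "h2_outer_cap d E =
     (INF G\<in>{G. openin (top_of_set (cx_sphere d)) G \<and> E \<subseteq> G}. h2_inner_cap d G)"

end

theory Submission
  imports Defs
begin

text \<open>
  The set \<open>{M\<^sub>\<alpha> f > t}\<close> is open, so it suffices to bound \<open>t\<^sup>2\<close> by \<open>C\<^sup>2 \<parallel>f\<parallel>\<^sup>2 \<E>(\<mu>)\<close> for \<open>\<mu>\<close> on a compact
  subset. Choosing \<open>z(\<zeta>) \<in> D\<^sub>\<alpha>(\<zeta>)\<close> with \<open>|f(z(\<zeta>))| > t\<close> and using that the kernel is positive,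
  \<open>t\<^sup>2 \<le> \<parallel>f\<parallel>\<^sup>2 N\<close> with \<open>N = \<integral>\<integral> k(z(\<zeta>), z(\<omega>)) d\<mu> d\<mu>\<close>. The point is the bound
  \<open>k(z(\<zeta>), z(\<omega>)) \<le> C (k(z(\<zeta>), r\<omega>) + k(r\<zeta>, z(\<omega>)))\<close> for \<open>r\<close> close to \<open>1\<close>: by Cauchy--Schwarz for the
  positive definite \<open>k\<close> it gives \<open>N \<le> 2C N\<^bsup>1/2\<^esup> \<E>(\<mu>)\<^bsup>1/2\<^esup>\<close>, that is \<open>N \<le> 4C\<^sup>2 \<E>(\<mu>)\<close>.
  Since \<open>k(z, w)\<close> is the Poisson kernel at \<open>\<langle>z, w\<rangle>\<close>, Harnack's inequality allows all
  integrals to be replaced by finite sums.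
\<close>

section \<open>Finite combinations of kernel functions and Cauchy-Schwarz in a reproducing kernel
  Hilbert space\<close>

lemma (in rkhs) sum_mem:
  assumes "finite I" "\<And>i. i \<in> I \<Longrightarrow> g i \<in> H"
  shows "(\<lambda>x. \<Sum>i\<in>I. b i * g i x) \<in> H"
  using assms
proof (induction I rule: finite_induct)
  case empty
  then show ?case using zero_mem by simp
next
  case (insert i I)
  then show ?case using add_mem[OF scale_mem[of "g i" "b i"]] by simp
qed

lemma (in rkhs) ip_sum_left:
  assumes "finite I" "\<And>i. i \<in> I \<Longrightarrow> g i \<in> H" "h \<in> H"
  shows "ip (\<lambda>x. \<Sum>i\<in>I. b i * g i x) h = (\<Sum>i\<in>I. b i * ip (g i) h)"
  using assms
proof (induction I rule: finite_induct)
  case empty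
  then show ?case using ip_scale_left[OF zero_mem, of h 0] by simp
next
  case (insert i I)
  have "(\<lambda>x. b i * g i x) \<in> H" "(\<lambda>x. \<Sum>i\<in>I. b i * g i x) \<in> H"
    using insert by (simp_all add: scale_mem sum_mem)
  with insert show ?case
    using ip_add_left[of "\<lambda>x. b i * g i x" "\<lambda>x. \<Sum>i\<in>I. b i * g i x" h] ip_scale_left[of "g i" h "b i"]
    by simp
qed

lemma (in rkhs) ip_self_real:
  assumes "f \<in> H"
  shows "ip f f = complex_of_real (Re (ip f f))"
  using ip_commute[OF assms assms] by (metis complex_cnj_cancel_iff Reals_cnj_iff of_real_Re)

text \<open>Removing from \<open>f\<close> its projection onto \<open>g\<close> leaves an
  \<open>h\<close> orthogonal to \<open>g\<close>, and nonnegativity of \<open>ip h h\<close> is the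
  inequality. If \<open>ip g g = 0\<close>, definiteness makes both sides vanish.\<close>

lemma (in rkhs) ip_Cauchy_Schwarz:
  assumes f: "f \<in> H" and g: "g \<in> H"
  shows "(cmod (ip f g))\<^sup>2 \<le> Re (ip f f) * Re (ip g g)"
proof (cases "ip g g = 0")
  case True
  then have "g = (\<lambda>x. 0)" using ip_definite g by blast
  then have "ip g f = 0" using ip_scale_left[OF g f, of 0] by simp
  then have "ip f g = 0" using ip_commute[OF g f] by simp
  then show ?thesis using True by simp
next
  case False
  define n where "n = Re (ip g g)"
  have gg: "ip g g = complex_of_real n"
    unfolding n_def by (rule ip_self_real[OF g])
  have n: "n > 0"
    using False gg ip_nonneg[OF g] unfolding n_def by (metis less_eq_real_def of_real_0)
  define c where "c = - ip f g / complex_of_real n"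
  define h where "h = (\<lambda>x. f x + c * g x)"
  have cg: "(\<lambda>x. c * g x) \<in> H" using scale_mem g by blast
  have h: "h \<in> H" unfolding h_def using add_mem f cg by blast
  have hg: "ip h g = 0"
    unfolding h_def using ip_add_left[OF f cg g] ip_scale_left[OF g g, of c] n
    by (simp add: c_def gg)
  have "ip h h = ip f h + c * ip g h"
    using ip_add_left[OF f cg h] ip_scale_left[OF g h, of c] by (simp add: h_def)
  also have "ip g h = 0" using ip_commute[OF h g] hg by simp
  also have "ip f h = cnj (ip h f)" by (rule ip_commute[OF h f])
  also have "ip h f = ip f f + c * ip g f"
    using ip_add_left[OF f cg f] ip_scale_left[OF g f, of c] by (simp add: h_def)
  also have "c * ip g f = - complex_of_real ((cmod (ip f g))\<^sup>2 / n)"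
    unfolding c_def ip_commute[OF f g] using complex_norm_square[of "ip f g"] by simp
  finally have "Re (ip h h) = Re (ip f f) - (cmod (ip f g))\<^sup>2 / n"
    by simp
  then show ?thesis
    using ip_nonneg[OF h] n unfolding n_def[symmetric] by (simp add: pos_divide_le_eq)
qed

text \<open>By the reproducing property, pairing with a combination of kernel functions is
  evaluation at its nodes. Values and pairings are both recorded because together they compute
  \<open>ip h h\<close>.\<close>

lemma (in rkhs) kernel_sum:
  assumes "finite I" "\<And>i. i \<in> I \<Longrightarrow> x i \<in> X"
  obtains h where "h \<in> H"
    "\<forall>y\<in>X. h y = (\<Sum>i\<in>I. b i * K y (x i))"
    "\<forall>g\<in>H. ip g h = (\<Sum>i\<in>I. cnj (b i) * g (x i))"
proof -
  define k where "k = (\<lambda>i y. if y \<in> X then K y (x i) else 0)"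
  define h where "h = (\<lambda>y. \<Sum>i\<in>I. b i * k i y)"
  have k: "k i \<in> H" if "i \<in> I" for i
    unfolding k_def using kernel_mem assms(2)[OF that] by blast
  have h: "h \<in> H" unfolding h_def by (rule sum_mem[OF assms(1) k])
  have eval: "ip g h = (\<Sum>i\<in>I. cnj (b i) * g (x i))" if g: "g \<in> H" for g
  proof -
    have "ip h g = (\<Sum>i\<in>I. b i * ip (k i) g)"
      unfolding h_def by (rule ip_sum_left[OF assms(1) k g])
    also have "\<dots> = (\<Sum>i\<in>I. b i * cnj (g (x i)))"
    proof (rule sum.cong[OF refl])
      fix i assume i: "i \<in> I"
      have "g (x i) = ip g (k i)" unfolding k_def by (rule reproducing[OF g assms(2)[OF i]])
      then show "b i * ip (k i) g = b i * cnj (g (x i))"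
        using ip_commute[OF g k[OF i]] by simp
    qed
    finally show ?thesis using ip_commute[OF h g] by simp
  qed
  have "h y = (\<Sum>i\<in>I. b i * K y (x i))" if "y \<in> X" for y
    using that by (simp add: h_def k_def)
  with h eval show ?thesis using that by blast
qed

text \<open>Cauchy-Schwarz against the combination of kernel functions at the nodes
  \<open>x i\<close>, whose square norm is the quadratic form on the right. The capacity bound uses
  it twice: for \<open>f\<close>, and for a potential built from kernels.\<close>

lemma (in rkhs) eval_sum_le:
  assumes "finite I" "\<And>i. i \<in> I \<Longrightarrow> x i \<in> X" "f \<in> H"
  shows "(cmod (\<Sum>i\<in>I. cnj (b i) * f (x i)))\<^sup>2
           \<le> Re (ip f f) * Re (\<Sum>i\<in>I. \<Sum>j\<in>I. cnj (b i) * b j * K (x i) (x j))"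
proof -
  obtain h where h: "h \<in> H" "\<forall>y\<in>X. h y = (\<Sum>i\<in>I. b i * K y (x i))"
    "\<forall>g\<in>H. ip g h = (\<Sum>i\<in>I. cnj (b i) * g (x i))"
    by (rule kernel_sum[OF assms(1,2), where b = b])
  have "ip h h = (\<Sum>i\<in>I. \<Sum>j\<in>I. cnj (b i) * b j * K (x i) (x j))"
    unfolding h(3)[rule_format, OF h(1)] by (simp add: h(2) assms(2) sum_distrib_left mult.assoc)
  then show ?thesis
    using ip_Cauchy_Schwarz[OF assms(3) h(1)] h(3) assms(3) by simp
qed

section \<open>The Poisson kernel of the disc and Harnack-type comparisons\<close>

text \<open>The Poisson kernel of the unit disc for the boundary point 1. The kernel of the space is
  its value at the Hermitian product of the two points.\<close>

definition poisson :: "complex \<Rightarrow> real" where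
  "poisson a = (1 - (cmod a)\<^sup>2) / (cmod (1 - a))\<^sup>2"

lemma poisson_nonneg: "cmod a \<le> 1 \<Longrightarrow> 0 \<le> poisson a"
  unfolding poisson_def by (simp add: power_le_one)

lemma poisson_cnj: "poisson (cnj a) = poisson a"
  unfolding poisson_def by (metis complex_cnj_diff complex_cnj_one complex_mod_cnj)

lemma poisson_eq_Re:
  assumes "a \<noteq> 1"
  shows "2 * Re (1 / (1 - a)) - 1 = poisson a"
proof -
  have nz: "(cmod (1 - a))\<^sup>2 \<noteq> 0" using assms by simp
  have re: "Re (1 / (1 - a)) = (1 - Re a) / (cmod (1 - a))\<^sup>2"
    by (simp add: Re_divide cmod_power2)
  have "2 * Re (1 / (1 - a)) - 1 = (2 * (1 - Re a) - (cmod (1 - a))\<^sup>2) / (cmod (1 - a))\<^sup>2"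
    using nz by (simp add: re diff_divide_distrib right_diff_distrib)
  also have "2 * (1 - Re a) - (cmod (1 - a))\<^sup>2 = 1 - (cmod a)\<^sup>2"
    unfolding cmod_power2 by (simp add: power2_eq_square algebra_simps)
  finally show ?thesis unfolding poisson_def .
qed

text \<open>Numerators and denominators are compared separately; the denominator is a square, whence
  the square of \<open>P\<close>. The factor 2 arises because 1 - |a|^2 lies between 1 - |a| and
  twice that. All comparisons of kernel values below reduce to this one.\<close>

lemma poisson_le:
  assumes a: "cmod a < 1" and b: "cmod b < 1" and Q: "0 \<le> Q"
    and den: "cmod (1 - b) \<le> P * cmod (1 - a)"
    and num: "1 - cmod a \<le> Q * (1 - cmod b)"
  shows "poisson a \<le> 2 * Q * P\<^sup>2 * poisson b"
proof -
  have pos: "cmod (1 - a) > 0" "cmod (1 - b) > 0" using a b by auto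
  have sq: "(cmod (1 - b))\<^sup>2 \<le> P\<^sup>2 * (cmod (1 - a))\<^sup>2"
    using power_mono[OF den, of 2] by (simp add: power_mult_distrib)
  have "1 - (cmod a)\<^sup>2 = (1 + cmod a) * (1 - cmod a)"
    by (simp add: power2_eq_square algebra_simps)
  also have "\<dots> \<le> 2 * (1 - cmod a)"
    using a by (intro mult_right_mono) auto
  also have "\<dots> \<le> 2 * (Q * (1 - cmod b))"
    using num by simp
  also have "\<dots> \<le> 2 * (Q * (1 - (cmod b)\<^sup>2))"
    using b Q by (intro mult_left_mono) (auto simp: power2_eq_square mult_left_le)
  finally have n: "1 - (cmod a)\<^sup>2 \<le> 2 * Q * (1 - (cmod b)\<^sup>2)" by simp
  have b2: "0 \<le> 1 - (cmod b)\<^sup>2" using b by (simp add: power_le_one)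
  have "(1 - (cmod a)\<^sup>2) * (cmod (1 - b))\<^sup>2
      \<le> (2 * Q * (1 - (cmod b)\<^sup>2)) * (P\<^sup>2 * (cmod (1 - a))\<^sup>2)"
    using n sq Q b2 by (intro mult_mono) auto
  then show ?thesis
    using pos by (simp add: poisson_def field_simps)
qed

text \<open>Dilating by \<open>r\<close> moves \<open>a\<close> by at most 1 - r, which is at most 1
  - |a| and so at most |1 - a|. Hence the denominator comparison holds with \<open>P = 2\<close>,
  and 8 is 2 * 1 * 2^2.\<close>

lemma poisson_scale_ge:
  assumes "cmod a \<le> r" "r < 1"
  shows "poisson a \<le> 8 * poisson (complex_of_real r * a)"
proof -
  have r: "0 \<le> r" using assms norm_ge_zero[of a] by linarith
  have ra: "cmod (complex_of_real r * a) \<le> cmod a"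
    using assms r by (simp add: norm_mult mult_left_le_one_le)
  have "cmod (1 - complex_of_real r * a) \<le> cmod (1 - a) + cmod (complex_of_real (1 - r) * a)"
    by (rule order_trans[OF _ norm_triangle_ineq]) (simp add: algebra_simps)
  also have "cmod (complex_of_real (1 - r) * a) \<le> 1 - r"
    using assms by (simp only: norm_mult norm_of_real) (simp add: mult_left_le)
  also have "1 - r \<le> cmod (1 - a)"
    using norm_triangle_ineq2[of 1 a] assms by simp
  finally have "cmod (1 - complex_of_real r * a) \<le> 2 * cmod (1 - a)" by simp
  then show ?thesis
    using poisson_le[of a "complex_of_real r * a" 1 2] ra assms by simp
qed

text \<open>Harnack's inequality in explicit form: the displacement is at most half the distance
  from the disc of radius \<open>s\<close> to the unit circle. The constants \<open>P = 3/2\<close>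
  and \<open>Q = 2\<close> give 9.\<close>

lemma poisson_near:
  assumes "cmod a \<le> s" "cmod b \<le> s" "s < 1" "cmod (a - b) \<le> (1 - s) / 2"
  shows "poisson a \<le> 9 * poisson b"
proof -
  have 1: "1 - s \<le> cmod (1 - a)" using norm_triangle_ineq2[of 1 a] assms by simp
  have "cmod (1 - b) \<le> cmod (1 - a) + cmod (a - b)"
    using norm_triangle_ineq[of "1 - a" "a - b"] by simp
  then have den: "cmod (1 - b) \<le> 3/2 * cmod (1 - a)" using 1 assms(4) by argo
  have "cmod b \<le> cmod a + cmod (a - b)"
    using norm_triangle_ineq4[of a "a - b"] by simp
  then have num: "1 - cmod a \<le> 2 * (1 - cmod b)" using assms by argo
  show ?thesis
    using poisson_le[OF _ _ _ den num] assms by (simp add: power2_eq_square)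
qed

section \<open>The Hermitian product and the quasi-metric |1 - <z,w>|\<close>

lemma cnj_hprod: "cnj (hprod d z w) = hprod d w z"
  by (simp add: hprod_def mult.commute)

lemma hprod_diff_left: "hprod d (\<lambda>i. x i - y i) w = hprod d x w - hprod d y w"
  by (simp add: hprod_def sum_subtractf left_diff_distrib)

lemma hprod_diff_right: "hprod d w (\<lambda>i. x i - y i) = hprod d w x - hprod d w y"
  by (simp add: hprod_def sum_subtractf right_diff_distrib)

lemma hprod_scale_left: "hprod d (\<lambda>i. c * x i) w = c * hprod d x w"
  by (simp add: hprod_def sum_distrib_left mult.assoc)

lemma hprod_scale_right: "hprod d w (\<lambda>i. c * x i) = cnj c * hprod d w x"
  by (simp add: hprod_def sum_distrib_left algebra_simps)

lemma hnorm_nonneg: "0 \<le> hnorm d z"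
  by (simp add: hnorm_def)

lemma hprod_self: "hprod d z z = complex_of_real ((hnorm d z)\<^sup>2)"
proof -
  have "(hnorm d z)\<^sup>2 = (\<Sum>i<d. (cmod (z i))\<^sup>2)"
    by (simp add: hnorm_def L2_set_def sum_nonneg)
  then show ?thesis
    by (simp add: hprod_def complex_norm_square del: of_real_power)
qed

lemma hnorm_scale: "hnorm d (\<lambda>i. c * x i) = cmod c * hnorm d x"
  by (simp add: hnorm_def norm_mult L2_set_right_distrib)

lemma hprod_le: "cmod (hprod d z w) \<le> hnorm d z * hnorm d w"
proof -
  have "cmod (hprod d z w) \<le> (\<Sum>i<d. \<bar>cmod (z i)\<bar> * \<bar>cmod (w i)\<bar>)"
    unfolding hprod_def by (rule order_trans[OF norm_sum]) (simp add: norm_mult)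
  also have "\<dots> \<le> hnorm d z * hnorm d w"
    unfolding hnorm_def by (rule L2_set_mult_ineq)
  finally show ?thesis .
qed

lemma hprod_le1:
  assumes "hnorm d z \<le> 1"
  shows "cmod (hprod d z w) \<le> hnorm d w"
  using hprod_le[of d z w] mult_right_mono[OF assms hnorm_nonneg[of d w]] by simp

lemma hprod_le2:
  assumes "hnorm d w \<le> 1"
  shows "cmod (hprod d z w) \<le> hnorm d z"
  using hprod_le[of d z w] mult_left_mono[OF assms hnorm_nonneg[of d z]] by simp

lemma norm_le_cmod_one_minus:
  assumes "hnorm d w \<le> 1"
  shows "1 - hnorm d z \<le> cmod (1 - hprod d z w)"
  using hprod_le2[OF assms, of z] norm_triangle_ineq2[of 1 "hprod d z w"] by simp

lemma one_minus_sq_le: "0 \<le> x \<Longrightarrow> 1 - x\<^sup>2 \<le> 2 * (1 - x)" for x :: real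
  using zero_le_power2[of "1 - x"] by (simp add: power2_eq_square algebra_simps)

text \<open>Expanding the square gives |x|^2 + |y|^2 - 2 Re <x,y>, which is at most 2 Re (1 - <x,y>)
  in the closed ball.\<close>

lemma hnorm_diff_sq_le:
  assumes "hnorm d x \<le> 1" "hnorm d y \<le> 1"
  shows "(hnorm d (\<lambda>i. x i - y i))\<^sup>2 \<le> 2 * cmod (1 - hprod d x y)"
proof -
  have "complex_of_real ((hnorm d (\<lambda>i. x i - y i))\<^sup>2)
      = complex_of_real ((hnorm d x)\<^sup>2) - hprod d x y - (cnj (hprod d x y) - complex_of_real ((hnorm d y)\<^sup>2))"
    unfolding hprod_self[symmetric] hprod_diff_left hprod_diff_right cnj_hprod by simp
  from arg_cong[OF this, of Re]
  have "(hnorm d (\<lambda>i. x i - y i))\<^sup>2 = (hnorm d x)\<^sup>2 + (hnorm d y)\<^sup>2 - 2 * Re (hprod d x y)"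
    by simp
  moreover have "(hnorm d x)\<^sup>2 \<le> 1" "(hnorm d y)\<^sup>2 \<le> 1"
    using assms by (simp_all add: power_le_one hnorm_nonneg)
  ultimately show ?thesis
    using complex_Re_le_cmod[of "1 - hprod d x y"] by simp
qed

text \<open>The identity \<open>eq\<close> splits 1 - <x,y> into the two wanted terms, the defect 1
  - |v|^2 and the cross term <x - v, v - y>. The cross term costs another \<open>A + B\<close>, the
  defect at most \<open>2 * B\<close>; this accounts for the asymmetric constants 2 and 4.\<close>

lemma quasi_triangle:
  assumes x: "hnorm d x \<le> 1" and v: "hnorm d v \<le> 1" and y: "hnorm d y \<le> 1"
  shows "cmod (1 - hprod d x y) \<le> 2 * cmod (1 - hprod d x v) + 4 * cmod (1 - hprod d v y)"
proof -
  define A where "A = cmod (1 - hprod d x v)"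
  define B where "B = cmod (1 - hprod d v y)"
  let ?p = "hnorm d (\<lambda>i. x i - v i)" and ?q = "hnorm d (\<lambda>i. v i - y i)"
  have vv: "1 - (hnorm d v)\<^sup>2 \<le> 2 * B"
    using one_minus_sq_le[OF hnorm_nonneg[of d v]] norm_le_cmod_one_minus[OF y, of v]
    by (simp add: B_def)
  have v1: "(hnorm d v)\<^sup>2 \<le> 1" using v by (simp add: power_le_one hnorm_nonneg)
  have "cmod (hprod d (\<lambda>i. x i - v i) (\<lambda>i. v i - y i)) \<le> ?p * ?q"
    by (rule hprod_le)
  also have "\<dots> \<le> (?p\<^sup>2 + ?q\<^sup>2) / 2"
    using sum_squares_bound[of ?p ?q] by simp
  also have "\<dots> \<le> A + B"
    using hnorm_diff_sq_le[OF x v] hnorm_diff_sq_le[OF v y] by (simp add: A_def B_def)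
  finally have cross: "cmod (hprod d (\<lambda>i. x i - v i) (\<lambda>i. v i - y i)) \<le> A + B" .
  have eq: "1 - hprod d x y = (1 - hprod d x v) + (1 - hprod d v y)
      - complex_of_real (1 - (hnorm d v)\<^sup>2) + hprod d (\<lambda>i. x i - v i) (\<lambda>i. v i - y i)"
    unfolding hprod_diff_left hprod_diff_right by (simp add: hprod_self)
  have "cmod (1 - hprod d x y) \<le> A + B + cmod (complex_of_real (1 - (hnorm d v)\<^sup>2)) + (A + B)"
    using norm_triangle_ineq[of "1 - hprod d x v" "1 - hprod d v y"] cross norm_triangle_ineq4[of "(1 - hprod d x v) + (1 - hprod d v y)" "complex_of_real (1 - (hnorm d v)\<^sup>2)"]
      norm_triangle_ineq[of "(1 - hprod d x v) + (1 - hprod d v y) - complex_of_real (1 - (hnorm d v)\<^sup>2)" "hprod d (\<lambda>i. x i - v i) (\<lambda>i. v i - y i)"]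
    unfolding eq[symmetric] A_def B_def by linarith
  also have "cmod (complex_of_real (1 - (hnorm d v)\<^sup>2)) = 1 - (hnorm d v)\<^sup>2"
    using v1 by (simp only: norm_of_real)
  finally show ?thesis using vv by (simp add: A_def B_def)
qed

lemma exists_unimodular_rotation: "\<exists>c. cmod c = 1 \<and> c * a = complex_of_real (cmod a)"
proof (cases "a = 0")
  case True
  then show ?thesis by (intro exI[of _ 1]) simp
next
  case False
  then show ?thesis
    by (intro exI[of _ "cnj a / complex_of_real (cmod a)"])
      (simp add: norm_divide complex_norm_square[symmetric] mult.commute power2_eq_square)
qed

text \<open>Multiplying \<open>x\<close> and \<open>y\<close> by unimodular scalars makes <x,v> and
  <v,y> nonnegative reals, for which |1 - s| is 1 - s; then \<open>quasi_triangle\<close>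
  applies.\<close>

lemma quasi_triangle_abs:
  assumes x: "hnorm d x \<le> 1" and v: "hnorm d v \<le> 1" and y: "hnorm d y \<le> 1"
  shows "1 - cmod (hprod d x y) \<le> 2 * (1 - cmod (hprod d x v)) + 4 * (1 - cmod (hprod d v y))"
proof -
  obtain c where c: "cmod c = 1" "c * hprod d x v = complex_of_real (cmod (hprod d x v))"
    using exists_unimodular_rotation by blast
  obtain e where e: "cmod e = 1" "e * hprod d v y = complex_of_real (cmod (hprod d v y))"
    using exists_unimodular_rotation by blast
  \<comment> \<open>The conjugate of \<open>e\<close> appears because the product is
    conjugate-linear in its second argument.\<close>
  let ?x = "\<lambda>i. c * x i" and ?y = "\<lambda>i. cnj e * y i"
  have one_minus: "cmod (1 - complex_of_real s) = 1 - s" if "s \<le> 1" for s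
    using that norm_of_real[of "1 - s", where 'a = complex] by simp
  have n: "hnorm d ?x \<le> 1" "hnorm d ?y \<le> 1"
    using x y c(1) e(1) by (simp_all add: hnorm_scale)
  have xv: "cmod (1 - hprod d ?x v) = 1 - cmod (hprod d x v)"
    and vy: "cmod (1 - hprod d v ?y) = 1 - cmod (hprod d v y)"
    unfolding hprod_scale_left hprod_scale_right complex_cnj_cnj c(2) e(2)
    using hprod_le2[OF v, of x] hprod_le1[OF v, of y] x y by (auto intro!: one_minus)
  have "cmod (hprod d ?x ?y) = cmod (hprod d x y)"
    using c(1) e(1) by (simp add: hprod_scale_left hprod_scale_right norm_mult)
  then have "1 - cmod (hprod d x y) \<le> cmod (1 - hprod d ?x ?y)"
    using norm_triangle_ineq2[of 1 "hprod d ?x ?y"] by simp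
  also have "\<dots> \<le> 2 * cmod (1 - hprod d ?x v) + 4 * cmod (1 - hprod d v ?y)"
    by (rule quasi_triangle[OF n(1) v n(2)])
  finally show ?thesis unfolding xv vy .
qed

section \<open>Kernel comparison between points of Koranyi regions and their boundary points\<close>

text \<open>The geometric core. The quasi-triangle inequality through \<open>w\<close> compares the
  denominators, its version for moduli through \<open>\<omega>\<close> the numerators. Both produce
  an error of order \<alpha> (1 - |w|); since |z| \<le> |w|, this is absorbed by |1 - <z,w>| in the
  first case and by 1 - |<z,\<omega>>| in the second. So \<open>P\<close> and \<open>Q\<close> are
  both \<open>2 + 4 * \<alpha>\<close>.\<close>

lemma poisson_koranyi:
  assumes z: "hnorm d z \<le> hnorm d w" and w: "hnorm d w < 1" and \<omega>: "hnorm d \<omega> = 1"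
    and w\<omega>: "cmod (1 - hprod d w \<omega>) \<le> \<alpha> / 2 * (1 - (hnorm d w)\<^sup>2)" and \<alpha>: "0 \<le> \<alpha>"
  shows "poisson (hprod d z w) \<le> 2 * (2 + 4 * \<alpha>) ^ 3 * poisson (hprod d z \<omega>)"
proof -
  define a where "a = hprod d z w"
  define b where "b = hprod d z \<omega>"
  have a: "cmod a < 1" using hprod_le2[of d w z] z w by (simp add: a_def)
  have b: "cmod b \<le> hnorm d z" using hprod_le2[of d \<omega> z] \<omega> by (simp add: b_def)
  have sq: "1 - (hnorm d w)\<^sup>2 \<le> 2 * (1 - hnorm d w)"
    by (rule one_minus_sq_le[OF hnorm_nonneg])
  have "1 - hnorm d w \<le> cmod (1 - a)"
    using norm_triangle_ineq2[of 1 a] hprod_le1[of d z w] z w by (simp add: a_def)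
  with sq have "\<alpha> * (1 - (hnorm d w)\<^sup>2) \<le> \<alpha> * (2 * cmod (1 - a))"
    using \<alpha> by (intro mult_left_mono) auto
  moreover have "cmod (1 - b) \<le> 2 * cmod (1 - a) + 4 * cmod (1 - hprod d w \<omega>)"
    unfolding a_def b_def using z w \<omega> by (intro quasi_triangle) auto
  ultimately have den: "cmod (1 - b) \<le> (2 + 4 * \<alpha>) * cmod (1 - a)"
    using w\<omega> by (simp add: algebra_simps)
  have "1 - hnorm d w \<le> 1 - cmod b" using z b by simp
  with sq have "\<alpha> * (1 - (hnorm d w)\<^sup>2) \<le> \<alpha> * (2 * (1 - cmod b))"
    using \<alpha> by (intro mult_left_mono) auto
  moreover have "1 - cmod a \<le> 2 * (1 - cmod b) + 4 * (1 - cmod (hprod d \<omega> w))"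
    unfolding a_def b_def using z w \<omega> by (intro quasi_triangle_abs) auto
  moreover have "1 - cmod (hprod d \<omega> w) \<le> cmod (1 - hprod d w \<omega>)"
    using norm_triangle_ineq2[of 1 "hprod d w \<omega>"] by (simp add: cnj_hprod[of d w \<omega>, symmetric])
  ultimately have num: "1 - cmod a \<le> (2 + 4 * \<alpha>) * (1 - cmod b)"
    using w\<omega> by (simp add: algebra_simps)
  show ?thesis
    using poisson_le[OF a _ _ den num] b z w \<alpha>
    by (simp add: a_def b_def power2_eq_square power3_eq_cube algebra_simps)
qed

lemma h2_kernel_poisson: "hprod d z w \<noteq> 1 \<Longrightarrow> h2_kernel d z w = poisson (hprod d z w)"
  unfolding h2_kernel_def by (rule poisson_eq_Re)

lemma hprod_less_one:
  assumes "z \<in> cx_ball d" "w \<in> cx_ball d"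
  shows "cmod (hprod d z w) < 1"
  using hprod_le2[of d w z] assms by (auto simp: cx_ball_def)

lemma h2_kernel_ball:
  assumes "z \<in> cx_ball d" "w \<in> cx_ball d"
  shows "h2_kernel d z w = poisson (hprod d z w)"
  using hprod_less_one[OF assms] by (intro h2_kernel_poisson) auto

lemma h2_kernel_nonneg:
  assumes "z \<in> cx_ball d" "w \<in> cx_ball d"
  shows "0 \<le> h2_kernel d z w"
  using hprod_less_one[OF assms] by (simp add: h2_kernel_ball[OF assms] poisson_nonneg)

lemma h2_kernel_sym:
  assumes "z \<in> cx_ball d" "w \<in> cx_ball d"
  shows "h2_kernel d z w = h2_kernel d w z"
  using poisson_cnj[of "hprod d z w"]
  by (simp add: h2_kernel_ball[OF assms] h2_kernel_ball[OF assms(2,1)] cnj_hprod)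

lemma scale_sphere_mem_ball:
  assumes "p \<in> cx_sphere d" "0 \<le> r" "r < 1"
  shows "(\<lambda>i. complex_of_real r * p i) \<in> cx_ball d"
  using assms by (auto simp: cx_sphere_def cx_ball_def cvec_def hnorm_scale)

text \<open>Two moves: \<open>w\<close> is replaced by its boundary point \<open>\<omega>\<close>,
  then \<open>\<omega>\<close> is pulled back to radius \<open>r\<close>, where the energy is
  computed. The second move costs a factor 8 because |z| \<le> r.\<close>

lemma h2_kernel_koranyi_half:
  assumes z: "z \<in> cx_ball d" and w: "w \<in> koranyi_region d \<alpha> \<omega>" and \<omega>: "\<omega> \<in> cx_sphere d"
    and \<alpha>: "0 \<le> \<alpha>" and zw: "hnorm d z \<le> hnorm d w" and r: "hnorm d z \<le> r" "r < 1"
  shows "h2_kernel d z w \<le> 16 * (2 + 4 * \<alpha>) ^ 3 * h2_kernel d z (\<lambda>i. complex_of_real r * \<omega> i)"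
proof -
  have wb: "w \<in> cx_ball d" using w by (simp add: koranyi_region_def)
  have r0: "0 \<le> r" using r hnorm_nonneg[of d z] by linarith
  have "h2_kernel d z w \<le> 2 * (2 + 4 * \<alpha>) ^ 3 * poisson (hprod d z \<omega>)"
    unfolding h2_kernel_ball[OF z wb] using zw w \<omega> \<alpha>
    by (intro poisson_koranyi) (auto simp: koranyi_region_def cx_ball_def cx_sphere_def)
  also have "poisson (hprod d z \<omega>) \<le> 8 * poisson (complex_of_real r * hprod d z \<omega>)"
    using hprod_le2[of d \<omega> z] \<omega> r by (intro poisson_scale_ge) (auto simp: cx_sphere_def)
  also have "poisson (complex_of_real r * hprod d z \<omega>) = h2_kernel d z (\<lambda>i. complex_of_real r * \<omega> i)"
    unfolding h2_kernel_ball[OF z scale_sphere_mem_ball[OF \<omega> r0 r(2)]] by (simp add: hprod_scale_right)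
  finally show ?thesis using \<alpha> by (simp add: mult_left_mono mult_ac)
qed

text \<open>Only the point of larger norm can be moved to the boundary. Taking the sum of the two
  mixed terms covers both cases at once, in a form symmetric in the two points.\<close>

lemma h2_kernel_koranyi:
  assumes z: "z \<in> koranyi_region d \<alpha> \<zeta>" "\<zeta> \<in> cx_sphere d" "hnorm d z \<le> r"
    and w: "w \<in> koranyi_region d \<alpha> \<omega>" "\<omega> \<in> cx_sphere d" "hnorm d w \<le> r"
    and \<alpha>: "0 \<le> \<alpha>" and r: "r < 1"
  shows "h2_kernel d z w \<le> 16 * (2 + 4 * \<alpha>) ^ 3 *
    (h2_kernel d z (\<lambda>i. complex_of_real r * \<omega> i) + h2_kernel d w (\<lambda>i. complex_of_real r * \<zeta> i))"
proof -
  have zb: "z \<in> cx_ball d" and wb: "w \<in> cx_ball d"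
    using z w by (simp_all add: koranyi_region_def)
  have r0: "0 \<le> r" using z(3) hnorm_nonneg[of d z] by linarith
  note nonneg = h2_kernel_nonneg[OF zb scale_sphere_mem_ball[OF w(2) r0 r]]
    h2_kernel_nonneg[OF wb scale_sphere_mem_ball[OF z(2) r0 r]]
  let ?C = "16 * (2 + 4 * \<alpha>) ^ 3"
  have C: "0 \<le> ?C" using \<alpha> by simp
  consider "hnorm d z \<le> hnorm d w" | "hnorm d w \<le> hnorm d z" by linarith
  then show ?thesis
  proof cases
    case 1
    have "h2_kernel d z w \<le> ?C * h2_kernel d z (\<lambda>i. complex_of_real r * \<omega> i)"
      by (rule h2_kernel_koranyi_half[OF zb w(1,2) \<alpha> 1 z(3) r])
    also have "\<dots> \<le> ?C * (h2_kernel d z (\<lambda>i. complex_of_real r * \<omega> i) + h2_kernel d w (\<lambda>i. complex_of_real r * \<zeta> i))"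
      using nonneg C by (intro mult_left_mono) auto
    finally show ?thesis .
  next
    case 2
    have "h2_kernel d z w \<le> ?C * h2_kernel d w (\<lambda>i. complex_of_real r * \<zeta> i)"
      unfolding h2_kernel_sym[OF zb wb]
      by (rule h2_kernel_koranyi_half[OF wb z(1,2) \<alpha> 2 w(3) r])
    also have "\<dots> \<le> ?C * (h2_kernel d z (\<lambda>i. complex_of_real r * \<omega> i) + h2_kernel d w (\<lambda>i. complex_of_real r * \<zeta> i))"
      using nonneg C by (intro mult_left_mono) auto
    finally show ?thesis .
  qed
qed

text \<open>Two displacements of (1 - r^2)/4 change the product by at most (1 - r^2)/2, the
  tolerance of \<open>poisson_near\<close> for the radius \<open>s = r^2\<close>.\<close>

lemma h2_kernel_near:
  assumes p: "p \<in> cx_sphere d" and q: "q \<in> cx_sphere d" and \<zeta>: "\<zeta> \<in> cx_sphere d" and \<omega>: "\<omega> \<in> cx_sphere d"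
    and r: "0 \<le> r" "r < 1"
    and "hnorm d (\<lambda>i. \<zeta> i - p i) \<le> (1 - r\<^sup>2) / 4" "hnorm d (\<lambda>i. \<omega> i - q i) \<le> (1 - r\<^sup>2) / 4"
  shows "h2_kernel d (\<lambda>i. complex_of_real r * p i) (\<lambda>i. complex_of_real r * q i)
      \<le> 9 * h2_kernel d (\<lambda>i. complex_of_real r * \<zeta> i) (\<lambda>i. complex_of_real r * \<omega> i)"
proof -
  have n: "hnorm d p \<le> 1" "hnorm d q \<le> 1" "hnorm d \<zeta> \<le> 1" "hnorm d \<omega> \<le> 1"
    using p q \<zeta> \<omega> by (simp_all add: cx_sphere_def)
  have r2: "r\<^sup>2 < 1" "0 \<le> r\<^sup>2" using r by (simp_all add: power_less_one_iff)
  let ?R = "complex_of_real (r\<^sup>2)"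
  have bd: "cmod (?R * hprod d x y) \<le> r\<^sup>2" if "hnorm d x \<le> 1" "hnorm d y \<le> 1" for x y
    using hprod_le2[OF that(2), of x] that(1) r2
    by (simp only: norm_mult norm_of_real) (simp add: mult_left_le)
  have eq: "hprod d p q - hprod d \<zeta> \<omega> =
      - hprod d (\<lambda>i. \<zeta> i - p i) q - hprod d \<zeta> (\<lambda>i. \<omega> i - q i)"
    unfolding hprod_diff_left hprod_diff_right by simp
  have "cmod (hprod d p q - hprod d \<zeta> \<omega>) \<le> (1 - r\<^sup>2) / 4 + (1 - r\<^sup>2) / 4"
    unfolding eq
    by (rule order_trans[OF norm_triangle_ineq4], unfold norm_minus_cancel)
      (intro add_mono order_trans[OF hprod_le2[OF n(2)] assms(7)] order_trans[OF hprod_le1[OF n(3)] assms(8)])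
  then have "cmod (hprod d p q - hprod d \<zeta> \<omega>) \<le> (1 - r\<^sup>2) / 2" by simp
  moreover have "cmod (?R * (hprod d p q - hprod d \<zeta> \<omega>)) \<le> cmod (hprod d p q - hprod d \<zeta> \<omega>)"
    using r2 by (simp only: norm_mult norm_of_real) (simp add: mult_left_le_one_le)
  ultimately have "cmod (?R * hprod d p q - ?R * hprod d \<zeta> \<omega>) \<le> (1 - r\<^sup>2) / 2"
    by (simp add: right_diff_distrib)
  from poisson_near[OF bd bd r2(1) this] n
  have "poisson (?R * hprod d p q) \<le> 9 * poisson (?R * hprod d \<zeta> \<omega>)" by blast
  then show ?thesis
    unfolding h2_kernel_ball[OF scale_sphere_mem_ball[OF p r] scale_sphere_mem_ball[OF q r]]
      h2_kernel_ball[OF scale_sphere_mem_ball[OF \<zeta> r] scale_sphere_mem_ball[OF \<omega> r]]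
    by (simp add: hprod_scale_left hprod_scale_right power2_eq_square mult.assoc)
qed

section \<open>The capacity estimate for finitely supported measures\<close>

text \<open>The weights \<open>c i\<close> stand for a discrete measure on the points
  \<open>p i\<close>. With \<open>N\<close> the energy at the approach points, \<open>R\<close> the
  energy at radius \<open>r\<close> and \<open>S\<close> the mixed one, the kernel comparison gives
  \<open>N \<le> 2 * A * S\<close> and Cauchy-Schwarz gives S^2 \<le> N R; together N \<le> (2 A)^2
  R.\<close>

lemma discrete_capacity_bound:
  assumes h2: "is_h2 d H ip" and f: "f \<in> H" and fin: "finite I"
    and z: "\<And>i. i \<in> I \<Longrightarrow> z i \<in> koranyi_region d \<alpha> (p i)"
    and p: "\<And>i. i \<in> I \<Longrightarrow> p i \<in> cx_sphere d"
    and zr: "\<And>i. i \<in> I \<Longrightarrow> hnorm d (z i) \<le> r"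
    and r: "0 \<le> r" "r < 1" and \<alpha>: "0 \<le> \<alpha>"
    and c: "\<And>i. i \<in> I \<Longrightarrow> 0 \<le> c i"
  shows "(\<Sum>i\<in>I. c i * cmod (f (z i)))\<^sup>2 \<le> (32 * (2 + 4 * \<alpha>) ^ 3)\<^sup>2 * (ip_norm ip f)\<^sup>2 *
     (\<Sum>i\<in>I. \<Sum>j\<in>I. c i * c j * h2_kernel d (\<lambda>n. complex_of_real r * p i n) (\<lambda>n. complex_of_real r * p j n))"
proof -
  interpret rkhs "cx_ball d" "\<lambda>z w. complex_of_real (h2_kernel d z w)" H ip
    using h2 by (simp add: is_h2_def)
  define q where "q = (\<lambda>i n. complex_of_real r * p i n)"
  define N where "N = (\<Sum>i\<in>I. \<Sum>j\<in>I. c i * c j * h2_kernel d (z i) (z j))"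
  define S where "S = (\<Sum>i\<in>I. \<Sum>j\<in>I. c i * c j * h2_kernel d (z i) (q j))"
  define R where "R = (\<Sum>i\<in>I. \<Sum>j\<in>I. c i * c j * h2_kernel d (q i) (q j))"
  define A where "A = 16 * (2 + 4 * \<alpha>) ^ 3"
  have zb: "z i \<in> cx_ball d" if "i \<in> I" for i using z[OF that] by (simp add: koranyi_region_def)
  have qb: "q i \<in> cx_ball d" if "i \<in> I" for i
    unfolding q_def by (rule scale_sphere_mem_ball[OF p[OF that] r])
  have A: "0 \<le> A" using \<alpha> by (simp add: A_def)
  have N0: "0 \<le> N" unfolding N_def using c zb by (intro sum_nonneg mult_nonneg_nonneg h2_kernel_nonneg) auto
  have R0: "0 \<le> R" unfolding R_def using c qb by (intro sum_nonneg mult_nonneg_nonneg h2_kernel_nonneg) auto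

  \<comment> \<open>The phases \<open>e i\<close> turn the sum of moduli into a linear functional of
    \<open>f\<close>.\<close>
  have "\<forall>i. \<exists>e. cmod e = 1 \<and> e * f (z i) = complex_of_real (cmod (f (z i)))"
    using exists_unimodular_rotation by blast
  then obtain e where e: "\<And>i. cmod (e i) = 1" "\<And>i. e i * f (z i) = complex_of_real (cmod (f (z i)))"
    by metis
  define b where "b = (\<lambda>i. complex_of_real (c i) * cnj (e i))"
  have "(\<Sum>i\<in>I. cnj (b i) * f (z i)) = complex_of_real (\<Sum>i\<in>I. c i * cmod (f (z i)))"
    by (simp add: b_def mult.assoc e(2))
  then have "(\<Sum>i\<in>I. c i * cmod (f (z i)))\<^sup>2 = (cmod (\<Sum>i\<in>I. cnj (b i) * f (z i)))\<^sup>2"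
    by (simp only: norm_of_real) simp
  also have "\<dots> \<le> Re (ip f f) *
      Re (\<Sum>i\<in>I. \<Sum>j\<in>I. cnj (b i) * b j * complex_of_real (h2_kernel d (z i) (z j)))"
    by (rule eval_sum_le[OF fin zb f])
  \<comment> \<open>Positivity of the kernel, beyond positive definiteness, lets the phases be
    discarded term by term.\<close>
  also have "Re (\<Sum>i\<in>I. \<Sum>j\<in>I. cnj (b i) * b j * complex_of_real (h2_kernel d (z i) (z j))) \<le> N"
    unfolding N_def Re_sum
  proof (intro sum_mono)
    fix i j assume ij: "i \<in> I" "j \<in> I"
    have "Re (cnj (b i) * b j * complex_of_real (h2_kernel d (z i) (z j)))
        \<le> cmod (cnj (b i) * b j * complex_of_real (h2_kernel d (z i) (z j)))"
      by (rule complex_Re_le_cmod)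
    also have "\<dots> = c i * c j * h2_kernel d (z i) (z j)"
      using c ij h2_kernel_nonneg[OF zb zb, OF ij] by (simp add: b_def norm_mult e(1))
    finally show "Re (cnj (b i) * b j * complex_of_real (h2_kernel d (z i) (z j)))
      \<le> c i * c j * h2_kernel d (z i) (z j)" .
  qed
  also have "Re (ip f f) = (ip_norm ip f)\<^sup>2"
    using ip_nonneg[OF f] by (simp add: ip_norm_def)
  finally have fN: "(\<Sum>i\<in>I. c i * cmod (f (z i)))\<^sup>2 \<le> (ip_norm ip f)\<^sup>2 * N"
    using ip_nonneg[OF f] by (simp add: mult_left_mono)

  have "N \<le> (\<Sum>i\<in>I. \<Sum>j\<in>I. c i * c j * (A * (h2_kernel d (z i) (q j) + h2_kernel d (z j) (q i))))"
    unfolding N_def A_def q_def using c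
    by (intro sum_mono mult_left_mono h2_kernel_koranyi z p zr \<alpha> r mult_nonneg_nonneg)
  also have "\<dots> = A * S + A * (\<Sum>i\<in>I. \<Sum>j\<in>I. c i * c j * h2_kernel d (z j) (q i))"
    unfolding S_def sum_distrib_left sum.distrib[symmetric] by (simp add: algebra_simps)
  also have "(\<Sum>i\<in>I. \<Sum>j\<in>I. c i * c j * h2_kernel d (z j) (q i)) = S"
    unfolding S_def by (subst sum.swap) (simp add: mult_ac)
  finally have NS: "N \<le> 2 * A * S" by simp

  \<comment> \<open>\<open>h\<close> is the potential of the weights placed at the approach points
    \<open>z j\<close>. Its square norm is \<open>N\<close>, and its weighted sum of values at the
    points \<open>q i\<close> is \<open>S\<close>.\<close>
  obtain h where h: "h \<in> H"
    "\<forall>y\<in>cx_ball d. h y = (\<Sum>j\<in>I. complex_of_real (c j) * complex_of_real (h2_kernel d y (z j)))"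
    "\<forall>g\<in>H. ip g h = (\<Sum>i\<in>I. cnj (complex_of_real (c i)) * g (z i))"
    by (rule kernel_sum[OF fin zb, where b = "\<lambda>i. complex_of_real (c i)"])
  have hh: "ip h h = complex_of_real N"
    unfolding h(3)[rule_format, OF h(1)] N_def by (simp add: h(2) zb sum_distrib_left mult.assoc)
  have "S = (\<Sum>i\<in>I. \<Sum>j\<in>I. c i * c j * h2_kernel d (q i) (z j))"
    unfolding S_def by (subst sum.swap) (intro sum.cong refl, simp add: h2_kernel_sym zb qb)
  then have "(\<Sum>i\<in>I. cnj (complex_of_real (c i)) * h (q i)) = complex_of_real S"
    by (simp add: h(2) qb sum_distrib_left mult.assoc)
  then have SNR: "S\<^sup>2 \<le> N * R"
    using eval_sum_le[where x = q and b = "\<lambda>i. complex_of_real (c i)", OF fin qb h(1)]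
    by (simp add: hh R_def)
  have "N * N \<le> (2 * A * S)\<^sup>2"
    using power_mono[OF NS N0, of 2] by (simp add: power2_eq_square)
  also have "\<dots> = (2 * A)\<^sup>2 * S\<^sup>2"
    by (rule power_mult_distrib)
  also have "\<dots> \<le> (2 * A)\<^sup>2 * (N * R)"
    using SNR by (intro mult_left_mono) auto
  \<comment> \<open>As a finite sum, \<open>N\<close> is a real number and may be cancelled.\<close>
  finally have "N * N \<le> N * ((2 * A)\<^sup>2 * R)" by (simp add: mult_ac)
  then have "N \<le> (2 * A)\<^sup>2 * R"
    using N0 R0 by (cases "N = 0") auto
  then have "(ip_norm ip f)\<^sup>2 * N \<le> (ip_norm ip f)\<^sup>2 * ((2 * A)\<^sup>2 * R)"
    by (intro mult_left_mono) auto
  with fN show ?thesis by (simp add: A_def R_def q_def mult_ac)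
qed

section \<open>Discretisation of measures and double integrals\<close>

text \<open>Each new set is reduced by those already treated. The pieces keep the index set
  \<open>P\<close>, so that every piece stays attached to its centre and to the approach point
  chosen for that centre.\<close>

lemma finite_disjoint_refinement:
  assumes "finite P" "\<And>p. p \<in> P \<Longrightarrow> V p \<in> sets M"
  obtains A where "\<forall>p\<in>P. A p \<subseteq> V p \<and> A p \<in> sets M"
    "disjoint_family_on A P" "(\<Union>p\<in>P. A p) = (\<Union>p\<in>P. V p)"
proof -
  have "\<exists>A. (\<forall>p\<in>P. A p \<subseteq> V p \<and> A p \<in> sets M) \<and> disjoint_family_on A P \<and> (\<Union>p\<in>P. A p) = (\<Union>p\<in>P. V p)"
    using assms
  proof (induction P rule: finite_induct)
    case empty
    then show ?case by (simp add: disjoint_family_on_def)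
  next
    case (insert x P)
    then obtain A where A: "\<forall>p\<in>P. A p \<subseteq> V p \<and> A p \<in> sets M" "disjoint_family_on A P"
      "(\<Union>p\<in>P. A p) = (\<Union>p\<in>P. V p)" by auto
    have "(\<Union>p\<in>P. V p) \<in> sets M" using insert by auto
    define B where "B = A(x := V x - (\<Union>p\<in>P. V p))"
    have Bx: "B x = V x - (\<Union>p\<in>P. V p)" and BP: "\<And>p. p \<in> P \<Longrightarrow> B p = A p"
      using insert.hyps(2) by (auto simp: B_def)
    have "(\<Union>p\<in>P. B p) = (\<Union>p\<in>P. V p)" using A(3) BP by simp
    then have un: "(\<Union>p\<in>insert x P. B p) = (\<Union>p\<in>insert x P. V p)" using Bx by auto
    have "disjoint_family_on B P" using A(2) BP by (simp add: disjoint_family_on_def)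
    moreover have "B x \<inter> (\<Union>p\<in>P. B p) = {}" using A(3) Bx BP by auto
    ultimately have "disjoint_family_on B (insert x P)"
      using insert.hyps(2) by (simp add: disjoint_family_on_insert)
    moreover have "B p \<subseteq> V p \<and> B p \<in> sets M" if "p \<in> insert x P" for p
      using that A(1) Bx BP \<open>(\<Union>p\<in>P. V p) \<in> sets M\<close> insert.prems by (cases "p = x") auto
    ultimately show ?case using un by blast
  qed
  then show ?thesis using that by blast
qed

text \<open>The step function with value \<open>a p q\<close> on the product of \<open>A p\<close>
  and \<open>A q\<close>, and 0 elsewhere, lies below the integrand; its iterated integral is the
  finite double sum.\<close>

lemma nn_integral_product_step_le:
  fixes g :: "'a \<Rightarrow> 'a \<Rightarrow> real"
  assumes "finite P" "disjoint_family_on A P" "\<And>p. p \<in> P \<Longrightarrow> A p \<in> sets M" "finite_measure M"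
    and le: "\<And>p q x y. p \<in> P \<Longrightarrow> q \<in> P \<Longrightarrow> x \<in> A p \<Longrightarrow> y \<in> A q \<Longrightarrow> a p q \<le> g x y"
    and a: "\<And>p q. p \<in> P \<Longrightarrow> q \<in> P \<Longrightarrow> 0 \<le> a p q"
  shows "ennreal (\<Sum>p\<in>P. \<Sum>q\<in>P. measure M (A p) * measure M (A q) * a p q)
      \<le> (\<integral>\<^sup>+x. \<integral>\<^sup>+y. ennreal (g x y) \<partial>M \<partial>M)"
proof -
  interpret finite_measure M by fact
  have step: "(\<Sum>p\<in>P. b p * indicator (A p) x) = b p'" if "x \<in> A p'" "p' \<in> P" for b :: "_ \<Rightarrow> ennreal" and x p'
  proof -
    have "(\<Sum>p\<in>P. b p * indicator (A p) x) = (\<Sum>p\<in>P. if p = p' then b p else 0)"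
      using that assms(2) by (intro sum.cong refl) (auto simp: disjoint_family_on_def indicator_def)
    then show ?thesis using assms(1) that by simp
  qed
  have zero: "(\<Sum>p\<in>P. b p * indicator (A p) x) = 0" if "x \<notin> (\<Union>p\<in>P. A p)" for b :: "_ \<Rightarrow> ennreal" and x
    using that by (intro sum.neutral) (auto simp: indicator_def)
  have int: "(\<integral>\<^sup>+x. (\<Sum>p\<in>P. b p * indicator (A p) x) \<partial>M) = (\<Sum>p\<in>P. b p * ennreal (measure M (A p)))"
    for b :: "_ \<Rightarrow> ennreal"
    using assms(3) by (subst nn_integral_sum) (auto simp: nn_integral_cmult_indicator emeasure_eq_measure)
  have inner: "(\<Sum>q\<in>P. ennreal (a p q) * ennreal (measure M (A q))) \<le> (\<integral>\<^sup>+y. ennreal (g x y) \<partial>M)"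
    if p: "p \<in> P" "x \<in> A p" for p x
    unfolding int[symmetric]
  proof (rule nn_integral_mono)
    fix y
    show "(\<Sum>q\<in>P. ennreal (a p q) * indicator (A q) y) \<le> ennreal (g x y)"
    proof (cases "y \<in> (\<Union>q\<in>P. A q)")
      case True
      then obtain q where q: "q \<in> P" "y \<in> A q" by blast
      show ?thesis unfolding step[OF q(2,1)] using le[OF p(1) q(1) p(2) q(2)] by (rule ennreal_leI)
    qed (simp add: zero)
  qed
  have "ennreal (\<Sum>p\<in>P. \<Sum>q\<in>P. measure M (A p) * measure M (A q) * a p q)
      = (\<Sum>p\<in>P. (\<Sum>q\<in>P. ennreal (a p q) * ennreal (measure M (A q))) * ennreal (measure M (A p)))"
    using a by (subst sum_ennreal[symmetric])
      (auto intro!: sum.cong sum_nonneg simp: ennreal_mult'[symmetric] sum_distrib_left sum_distrib_right mult_ac)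
  also have "\<dots> = (\<integral>\<^sup>+x. (\<Sum>p\<in>P. (\<Sum>q\<in>P. ennreal (a p q) * ennreal (measure M (A q))) * indicator (A p) x) \<partial>M)"
    by (rule int[symmetric])
  also have "\<dots> \<le> (\<integral>\<^sup>+x. \<integral>\<^sup>+y. ennreal (g x y) \<partial>M \<partial>M)"
  proof (rule nn_integral_mono)
    fix x
    show "(\<Sum>p\<in>P. (\<Sum>q\<in>P. ennreal (a p q) * ennreal (measure M (A q))) * indicator (A p) x)
      \<le> (\<integral>\<^sup>+y. ennreal (g x y) \<partial>M)"
    proof (cases "x \<in> (\<Union>q\<in>P. A q)")
      case True
      then obtain p where p: "p \<in> P" "x \<in> A p" by blast
      show ?thesis unfolding step[OF p(2,1)] by (rule inner[OF p])
    qed (simp add: zero)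
  qed
  finally show ?thesis .
qed

section \<open>Superlevel sets of the maximal function and the bound for a general measure\<close>

lemma continuous_on_hprod: "continuous_on S (\<lambda>\<zeta>. hprod d z \<zeta>)"
  unfolding hprod_def
  by (intro continuous_intros continuous_on_product_coordinates[THEN continuous_on_subset]) auto

lemma continuous_on_hnorm_diff: "continuous_on S (\<lambda>\<zeta>. hnorm d (\<lambda>i. \<zeta> i - p i))"
  unfolding hnorm_def L2_set_def
  by (intro continuous_intros continuous_on_product_coordinates[THEN continuous_on_subset]) auto

text \<open>The Koranyi condition read as a condition on \<zeta> for fixed \<open>z\<close>. It is
  not restricted to the sphere, so that it is open in the whole type and can be used in covers of
  compact sets.\<close>

definition koranyi_shadow :: "nat \<Rightarrow> real \<Rightarrow> (nat \<Rightarrow> complex) \<Rightarrow> (nat \<Rightarrow> complex) set" where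
  "koranyi_shadow d \<alpha> z = {\<zeta>. cmod (1 - hprod d z \<zeta>) < \<alpha> / 2 * (1 - (hnorm d z)\<^sup>2)}"

lemma mem_koranyi_shadow:
  "\<zeta> \<in> koranyi_shadow d \<alpha> z \<and> z \<in> cx_ball d \<longleftrightarrow> z \<in> koranyi_region d \<alpha> \<zeta>"
  by (auto simp: koranyi_shadow_def koranyi_region_def)

lemma open_koranyi_shadow: "open (koranyi_shadow d \<alpha> z)"
  unfolding koranyi_shadow_def
  by (intro open_Collect_less continuous_intros continuous_on_hprod)

lemma koranyi_max_superlevel:
  assumes "0 \<le> t"
  shows "{\<zeta> \<in> cx_sphere d. koranyi_max d \<alpha> f \<zeta> > ennreal t}
    = cx_sphere d \<inter> (\<Union>z\<in>{z\<in>cx_ball d. t < cmod (f z)}. koranyi_shadow d \<alpha> z)"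
  using assms mem_koranyi_shadow[of _ d \<alpha>]
  by (auto simp: koranyi_max_def less_SUP_iff ennreal_less_iff)

text \<open>Compactness is used twice: finitely many shadows cover \<open>F\<close>, which gives
  finitely many approach points, and finitely many small neighbourhoods cover \<open>F\<close>,
  which replaces \<mu> by weights on their centres.\<close>

lemma energy_bound:
  assumes h2: "is_h2 d H ip" and f: "f \<in> H" and t: "0 \<le> t" and \<alpha>: "0 \<le> \<alpha>"
    and F: "compact F" "F \<subseteq> {\<zeta> \<in> cx_sphere d. koranyi_max d \<alpha> f \<zeta> > ennreal t}"
    and \<mu>: "\<mu> \<in> sphere_prob d" "emeasure \<mu> (cx_sphere d - F) = 0"
  shows "ennreal (t\<^sup>2) \<le> ennreal ((96 * (2 + 4 * \<alpha>) ^ 3)\<^sup>2 * (ip_norm ip f)\<^sup>2) * h2_energy d \<mu>"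
proof -
  interpret \<mu>: prob_space \<mu> using \<mu> by (simp add: sphere_prob_def)
  have sets: "sets \<mu> = sets (restrict_space borel (cx_sphere d))" using \<mu> by (simp add: sphere_prob_def)
  have space: "space \<mu> = cx_sphere d" using sets_eq_imp_space_eq[OF sets] by (simp add: space_restrict_space)
  have meas: "V \<inter> cx_sphere d \<in> sets \<mu>" if "V \<in> sets borel" for V
    unfolding sets using that by (auto simp: sets_restrict_space)
  have FS: "F \<subseteq> cx_sphere d" using F by auto
  have Fsub: "F \<subseteq> (\<Union>z\<in>{z\<in>cx_ball d. t < cmod (f z)}. koranyi_shadow d \<alpha> z)"
    using F(2) unfolding koranyi_max_superlevel[OF t] by blast
  obtain Z where Z: "Z \<subseteq> {z\<in>cx_ball d. t < cmod (f z)}" "finite Z" "F \<subseteq> (\<Union>z\<in>Z. koranyi_shadow d \<alpha> z)"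
    by (rule compactE_image[OF F(1) _ Fsub]) (auto simp: open_koranyi_shadow)
  \<comment> \<open>One radius below 1 for all approach points, available since \<open>Z\<close> is
    finite. The inserted 0 keeps the maximum meaningful for empty \<open>Z\<close>.\<close>
  define r where "r = Max (insert 0 (hnorm d ` Z))"
  have r: "0 \<le> r" "r < 1" "\<And>z. z \<in> Z \<Longrightarrow> hnorm d z \<le> r"
    unfolding r_def using Z by (auto simp: cx_ball_def)
  have "\<forall>p\<in>F. \<exists>z\<in>Z. p \<in> koranyi_shadow d \<alpha> z" using Z(3) by blast
  then obtain z where z: "\<And>p. p \<in> F \<Longrightarrow> z p \<in> Z" "\<And>p. p \<in> F \<Longrightarrow> p \<in> koranyi_shadow d \<alpha> (z p)"
    by metis

  \<comment> \<open>The radius is the tolerance in \<open>h2_kernel_near\<close>: on these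
    neighbourhoods the dilated kernel varies by a factor of at most 9.\<close>
  define V where "V = (\<lambda>p. {\<zeta>. hnorm d (\<lambda>i. \<zeta> i - p i) < (1 - r\<^sup>2) / 4})"
  have V: "open (V p)" for p
    unfolding V_def by (intro open_Collect_less continuous_on_hnorm_diff continuous_intros)
  have "r\<^sup>2 < 1" using r by (simp add: power_less_one_iff)
  then have "p \<in> V p" for p by (simp add: V_def hnorm_def L2_set_def)
  then have FV: "F \<subseteq> (\<Union>p\<in>F. V p)" by blast
  obtain P where P: "P \<subseteq> F" "finite P" "F \<subseteq> (\<Union>p\<in>P. V p)"
    by (rule compactE_image[OF F(1) _ FV]) (auto simp: V)
  obtain A where A: "\<forall>p\<in>P. A p \<subseteq> V p \<inter> cx_sphere d \<and> A p \<in> sets \<mu>"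
    "disjoint_family_on A P" "(\<Union>p\<in>P. A p) = (\<Union>p\<in>P. V p \<inter> cx_sphere d)"
    by (rule finite_disjoint_refinement[OF P(2) meas[OF borel_open[OF V]]])
  define c where "c = (\<lambda>p. measure \<mu> (A p))"
  \<comment> \<open>The pieces cover \<open>F\<close>, which carries \<mu>, so the weights
    \<open>c p\<close> add up to 1.\<close>
  have "AE x in \<mu>. x \<in> (\<Union>p\<in>P. A p)"
  proof (rule AE_I)
    show "{x \<in> space \<mu>. x \<notin> (\<Union>p\<in>P. A p)} \<subseteq> cx_sphere d - F"
      using P(3) by (auto simp: A(3) space)
    have "- F \<in> sets borel" using F(1) by (simp add: compact_imp_closed borel_open open_Compl)
    from meas[OF this] show "cx_sphere d - F \<in> sets \<mu>"
      by (simp add: Diff_eq Int_commute)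
  qed (rule \<mu>(2))
  then have "measure \<mu> (\<Union>p\<in>P. A p) = 1"
    using A(1) P(2) by (intro \<mu>.prob_eq_1[THEN iffD2]) auto
  then have c1: "(\<Sum>p\<in>P. c p) = 1"
    using \<mu>.finite_measure_finite_Union[OF P(2) _ A(2)] A(1) by (auto simp: c_def)

  let ?q = "\<lambda>p n. complex_of_real r * p n"
  define R where "R = (\<Sum>p\<in>P. \<Sum>q\<in>P. c p * c q * h2_kernel d (?q p) (?q q))"
  have sph: "p \<in> cx_sphere d" if "p \<in> P" for p using that P FS by blast
  have "t = (\<Sum>p\<in>P. c p * t)" using c1 by (simp add: sum_distrib_right[symmetric])
  also have "\<dots> \<le> (\<Sum>p\<in>P. c p * cmod (f (z p)))"
    using P(1) Z(1) z(1) by (intro sum_mono mult_left_mono) (force simp: c_def)+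
  finally have "t\<^sup>2 \<le> (\<Sum>p\<in>P. c p * cmod (f (z p)))\<^sup>2"
    using t by (intro power_mono)
  also have "\<dots> \<le> (32 * (2 + 4 * \<alpha>) ^ 3)\<^sup>2 * (ip_norm ip f)\<^sup>2 * R"
    unfolding R_def
  proof (rule discrete_capacity_bound[OF h2 f P(2) _ sph _ r(1,2) \<alpha>])
    show "z p \<in> koranyi_region d \<alpha> p" if "p \<in> P" for p
      using mem_koranyi_shadow[of p d \<alpha> "z p"] z that P(1) Z(1) by blast
    show "hnorm d (z p) \<le> r" if "p \<in> P" for p
      using r(3) z that P(1) by blast
  qed (simp_all add: c_def)
  finally have tR: "t\<^sup>2 \<le> (32 * (2 + 4 * \<alpha>) ^ 3)\<^sup>2 * (ip_norm ip f)\<^sup>2 * R" .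

  \<comment> \<open>The kernel at the centres, divided by the Harnack constant 9, is a lower bound
    on each product of pieces.\<close>
  have "ennreal (\<Sum>p\<in>P. \<Sum>q\<in>P. c p * c q * (h2_kernel d (?q p) (?q q) / 9))
      \<le> (\<integral>\<^sup>+z. \<integral>\<^sup>+w. ennreal (h2_kernel d (?q z) (?q w)) \<partial>\<mu> \<partial>\<mu>)"
    unfolding c_def
  proof (rule nn_integral_product_step_le[OF P(2) A(2)])
    show "A p \<in> sets \<mu>" if "p \<in> P" for p using A(1) that by blast
    show "finite_measure \<mu>" by (rule \<mu>.finite_measure_axioms)
  next
    fix p q x y assume *: "p \<in> P" "q \<in> P" "x \<in> A p" "y \<in> A q"
    have "x \<in> V p" "y \<in> V q" "x \<in> cx_sphere d" "y \<in> cx_sphere d" using A(1) * by auto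
    then have "h2_kernel d (?q p) (?q q) \<le> 9 * h2_kernel d (?q x) (?q y)"
      using sph * r by (intro h2_kernel_near) (auto simp: V_def)
    then show "h2_kernel d (?q p) (?q q) / 9 \<le> h2_kernel d (?q x) (?q y)" by simp
  next
    fix p q assume "p \<in> P" "q \<in> P"
    then show "0 \<le> h2_kernel d (?q p) (?q q) / 9"
      using h2_kernel_nonneg[OF scale_sphere_mem_ball scale_sphere_mem_ball] sph r by simp
  qed
  also have "\<dots> \<le> h2_energy d \<mu>"
    unfolding h2_energy_def using r by (intro SUP_upper) auto
  also have "(\<Sum>p\<in>P. \<Sum>q\<in>P. c p * c q * (h2_kernel d (?q p) (?q q) / 9)) = R / 9"
    by (simp add: R_def sum_divide_distrib)
  finally have RE: "ennreal (R / 9) \<le> h2_energy d \<mu>" .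

  let ?C = "(96 * (2 + 4 * \<alpha>) ^ 3)\<^sup>2 * (ip_norm ip f)\<^sup>2"
  \<comment> \<open>The constant 96 is 3 * 32: after squaring, the 3 compensates the division by
    9.\<close>
  have "t\<^sup>2 \<le> ?C * (R / 9)" using tR by (simp add: power_mult_distrib mult_ac)
  then have "ennreal (t\<^sup>2) \<le> ennreal (?C * (R / 9))" by (rule ennreal_leI)
  also have "\<dots> = ennreal ?C * ennreal (R / 9)" by (rule ennreal_mult') simp
  also have "\<dots> \<le> ennreal ?C * h2_energy d \<mu>" by (rule mult_left_mono[OF RE]) simp
  finally show ?thesis .
qed

section \<open>From the energy bound to the capacity bound\<close>

text \<open>Turns a lower bound on the energy into an upper bound on its reciprocal. Positivity of
  \<open>s\<close> excludes \<open>e = 0\<close>, and for infinite \<open>e\<close> the reciprocal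
  is 0.\<close>

lemma ennreal_inverse_le_of_le_mult:
  assumes "ennreal s \<le> ennreal b * e" "0 < s" "0 \<le> b"
  shows "1 / e \<le> ennreal (b / s)"
proof (cases e)
  case (real x)
  then have sb: "s \<le> b * x" using assms by (simp add: ennreal_mult[symmetric])
  then have "x \<noteq> 0" using assms by auto
  then have x: "0 < x" using real by simp
  then have "1 / x \<le> b / s" using sb assms by (simp add: field_simps)
  moreover have "1 / e = ennreal (1 / x)"
    using x real by (simp add: divide_ennreal[symmetric])
  ultimately show ?thesis by (simp add: ennreal_leI)
qed (simp add: ennreal_divide_top)

theorem theorem4p1:
  fixes \<alpha> :: real
  assumes "\<alpha> > 1"
  shows "\<exists>C::real. \<forall>d\<ge>1. \<forall>H ip. is_h2 d H ip \<longrightarrow>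
           (\<forall>f\<in>H. \<forall>t::real. t > 0 \<longrightarrow>
              h2_outer_cap d {\<zeta> \<in> cx_sphere d. koranyi_max d \<alpha> f \<zeta> > ennreal t}
                \<le> ennreal (C\<^sup>2 * (ip_norm ip f)\<^sup>2 / t\<^sup>2))"
proof (intro exI allI impI ballI)
  fix d H ip f and t :: real
  assume h2: "is_h2 d H ip" and f: "f \<in> H" and t: "t > 0"
  \<comment> \<open>The witness involves only \<alpha>, as the order of the quantifiers
    demands.\<close>
  let ?C = "96 * (2 + 4 * \<alpha>) ^ 3"
  let ?E = "{\<zeta> \<in> cx_sphere d. koranyi_max d \<alpha> f \<zeta> > ennreal t}"
  \<comment> \<open>Being relatively open, the set is itself a competitor in the infimum that
    defines its outer capacity, so only its compact subsets need to be estimated.\<close>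
  have "openin (top_of_set (cx_sphere d)) ?E"
    unfolding koranyi_max_superlevel[OF less_imp_le[OF t]]
    by (intro openin_open_Int open_UN ballI open_koranyi_shadow)
  then have "h2_outer_cap d ?E \<le> h2_inner_cap d ?E"
    unfolding h2_outer_cap_def by (intro INF_lower) auto
  also have "\<dots> \<le> ennreal (?C\<^sup>2 * (ip_norm ip f)\<^sup>2 / t\<^sup>2)"
    unfolding h2_inner_cap_def h2_cap_compact_def
    using energy_bound[OF h2 f, of t \<alpha>] assms t
    by (intro SUP_least ennreal_inverse_le_of_le_mult) auto
  finally show "h2_outer_cap d ?E \<le> ennreal (?C\<^sup>2 * (ip_norm ip f)\<^sup>2 / t\<^sup>2)" .
qed

end
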